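(* Let $k:I\to\mathbb{R}^+$ be a smooth function on an open interval $I$ with $0\in I$, let $p_0\in\mathbb{R}^2$ and $\theta_0^*\in\mathbb{R}$. Let $\nabla$ be a cl-connection on $\mathbb{R}^2$ determined by $(W,m,n)$, where $W=(\cos\theta_0,\sin\theta_0)$. Assume that $$2k(0)^2>\sin^2(\theta_0^*-\theta_0)\,\big(m(p_0)+n(p_0)\big)^2 .$$ Then there exists a unique local smooth curve $\gamma$ (defined on an open interval around $0$), parametrized by arc length, such that $\gamma(0)=p_0$, $\theta(0)=\theta_0^*$, and the geodesic curvature of $\gamma$ with respect to $\nabla$ is identically $k(s)$. Here $\theta(s)$ denotes the smooth angle function that the unit tangent $T(s)$ of $\gamma$ makes with the positive $x$-axis.
   Context: $\langle\cdot,\cdot\rangle$ is the Euclidean metric on $\mathbb{R}^2$ and $\nabla^0$ its Levi-Civita connection. Let $W$ be a constant unit vector field on $\mathbb{R}^2$ and let $m,n:\mathbb{R}^2\to\mathbb{R}$ be smooth functions, not both identically zero. The canonical linear connection (cl-connection) determined by $(W,m,n)$ is $$\nabla_XY=\nabla^0_XY+m\langle W,Y\rangle X+n\langle X,Y\rangle W .$$ For a smooth curve $\gamma$ parametrized by arc length, $T=\gamma'=(\cos\theta,\sin\theta)$ is the unit tangent, $N=(-\sin\theta,\cos\theta)$ the unit normal, and $\kappa=\theta'$ the (signed) Frenet curvature. The geodesic curvature $\kappa_g\ge 0$ of $\gamma$ with respect to $\nabla$ is defined by $\kappa_g^2=(\kappa+n\langle W,N\rangle)^2+(m\langle W,N\rangle-\kappa)^2$,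 with $m,n$ evaluated along $\gamma$.
   Formalization: The uniqueness claimed is false: κ_g = k is quadratic in κ and the hypothesis gives two distinct roots κ(0), each with its own curve; proved instead: exactly two admissible κ(0), and for each one a unique local curve γ with θ'(0) = κ(0). *)

theory Defs
  imports "HOL-Analysis.Analysis"
begin

text \<open>Both notions below are meant for open sets \<open>S\<close>. Smoothness is \<open>C\<^sup>\<infinity>\<close>.\<close>

primrec k_smooth_on :: "nat \<Rightarrow> 'a::real_normed_vector set \<Rightarrow> ('a \<Rightarrow> 'b::real_normed_vector) \<Rightarrow> bool"
  where
    "k_smooth_on 0 S f \<longleftrightarrow> continuous_on S f"
  | "k_smooth_on (Suc r) S f \<longleftrightarrow>
       (\<forall>x\<in>S. f differentiable (at x)) \<and>
       (\<forall>v. k_smooth_on r S (\<lambda>x. frechet_derivative f (at x) v))"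

definition smooth_on :: "'a::real_normed_vector set \<Rightarrow> ('a \<Rightarrow> 'b::real_normed_vector) \<Rightarrow> bool"
  where "smooth_on S f \<longleftrightarrow> (\<forall>r. k_smooth_on r S f)"

definition open_interval_around_0 :: "real set \<Rightarrow> bool"
  where "open_interval_around_0 J \<longleftrightarrow> open J \<and> is_interval J \<and> 0 \<in> J"

definition angle_vec :: "real \<Rightarrow> real^2"
  where "angle_vec t = vector [cos t, sin t]"

definition normal_vec :: "real \<Rightarrow> real^2"
  where "normal_vec t = vector [- sin t, cos t]"

text \<open>The Levi-Civita connection of the flat plane is the componentwise directional derivative.\<close>

definition flat_connection :: "(real^2 \<Rightarrow> real^2) \<Rightarrow> (real^2 \<Rightarrow> real^2) \<Rightarrow> real^2 \<Rightarrow> real^2"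
  where "flat_connection X Y p = frechet_derivative Y (at p) (X p)"

text \<open>A constant vector field is identified with its value \<open>W\<close>. The connection is an operator on
  smooth vector fields, so nothing is required of \<open>nabla\<close> on other arguments.\<close>

definition is_cl_connection ::
  "((real^2 \<Rightarrow> real^2) \<Rightarrow> (real^2 \<Rightarrow> real^2) \<Rightarrow> real^2 \<Rightarrow> real^2) \<Rightarrow>
     real^2 \<Rightarrow> (real^2 \<Rightarrow> real) \<Rightarrow> (real^2 \<Rightarrow> real) \<Rightarrow> bool"
  where
    "is_cl_connection nabla W m n \<longleftrightarrow>
       norm W = 1 \<and> smooth_on UNIV m \<and> smooth_on UNIV n \<and>
       \<not> ((\<forall>p. m p = 0) \<and> (\<forall>p. n p = 0)) \<and>
       (\<forall>X Y p. smooth_on UNIV X \<longrightarrow> smooth_on UNIV Y \<longrightarrow>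
          nabla X Y p = flat_connection X Y p + (m p * (W \<bullet> Y p)) *\<^sub>R X p
                        + (n p * (X p \<bullet> Y p)) *\<^sub>R W)"

definition arc_length_curve_on :: "real set \<Rightarrow> (real \<Rightarrow> real^2) \<Rightarrow> bool"
  where
    "arc_length_curve_on J \<gamma> \<longleftrightarrow>
       smooth_on J \<gamma> \<and> (\<forall>s\<in>J. norm (vector_derivative \<gamma> (at s)) = 1)"

definition angle_function_on :: "real set \<Rightarrow> (real \<Rightarrow> real^2) \<Rightarrow> (real \<Rightarrow> real) \<Rightarrow> bool"
  where
    "angle_function_on J \<gamma> \<theta> \<longleftrightarrow>
       smooth_on J \<theta> \<and> (\<forall>s\<in>J. vector_derivative \<gamma> (at s) = angle_vec (\<theta> s))"

text \<open>The geodesic curvature, with respect to the connection determined by \<open>(W, m, n)\<close>, of a curve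
  that passes through \<open>p\<close> with tangent angle \<open>t\<close> and signed Frenet curvature \<open>\<kappa>\<close>.\<close>

definition cl_curvature ::
  "real^2 \<Rightarrow> (real^2 \<Rightarrow> real) \<Rightarrow> (real^2 \<Rightarrow> real) \<Rightarrow> real^2 \<Rightarrow> real \<Rightarrow> real \<Rightarrow> real"
  where
    "cl_curvature W m n p t \<kappa> =
       sqrt ((\<kappa> + n p * (W \<bullet> normal_vec t))\<^sup>2 + (m p * (W \<bullet> normal_vec t) - \<kappa>)\<^sup>2)"

definition geodesic_curvature ::
  "real^2 \<Rightarrow> (real^2 \<Rightarrow> real) \<Rightarrow> (real^2 \<Rightarrow> real) \<Rightarrow> (real \<Rightarrow> real^2) \<Rightarrow> (real \<Rightarrow> real) \<Rightarrow> real \<Rightarrow> real"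
  where
    "geodesic_curvature W m n \<gamma> \<theta> s = cl_curvature W m n (\<gamma> s) (\<theta> s) (deriv \<theta> s)"

definition prescribed_curvature_curve ::
  "real^2 \<Rightarrow> (real^2 \<Rightarrow> real) \<Rightarrow> (real^2 \<Rightarrow> real) \<Rightarrow> real set \<Rightarrow> (real \<Rightarrow> real) \<Rightarrow> real^2 \<Rightarrow> real \<Rightarrow>
     real set \<Rightarrow> (real \<Rightarrow> real^2) \<Rightarrow> (real \<Rightarrow> real) \<Rightarrow> bool"
  where
    "prescribed_curvature_curve W m n I k p\<^sub>0 t\<^sub>0 J \<gamma> \<theta> \<longleftrightarrow>
       open_interval_around_0 J \<and> J \<subseteq> I \<and>
       arc_length_curve_on J \<gamma> \<and> angle_function_on J \<gamma> \<theta> \<and>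
       \<gamma> 0 = p\<^sub>0 \<and> \<theta> 0 = t\<^sub>0 \<and>
       (\<forall>s\<in>J. geodesic_curvature W m n \<gamma> \<theta> s = k s)"

text \<open>For given \<open>p\<close> and \<open>t\<close>, the equation \<open>cl_curvature W m n p t \<kappa> = c\<close> is quadratic in \<open>\<kappa>\<close>.
  Prescribing the geodesic curvature therefore determines the initial Frenet curvature only up to
  the choice of a root, and a curve can be unique only once this root has been chosen.\<close>

definition admissible_initial_curvatures ::
  "real^2 \<Rightarrow> (real^2 \<Rightarrow> real) \<Rightarrow> (real^2 \<Rightarrow> real) \<Rightarrow> real^2 \<Rightarrow> real \<Rightarrow> real \<Rightarrow> real set"
  where "admissible_initial_curvatures W m n p t c = {\<kappa>. cl_curvature W m n p t \<kappa> = c}"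

end

theory Submission
  imports Defs
begin

text \<open>Prescribing the geodesic curvature of a curve with tangent angle \<open>\<theta>\<close> is a quadratic equation for
  \<open>\<kappa> = \<theta>'\<close>. With \<open>w = \<langle>W, N\<rangle> = - sin (\<theta> - \<theta>\<^sub>0)\<close>, completing the square turns it into
  \<open>(2 \<kappa> - (m - n) w)\<^sup>2 = 2 k\<^sup>2 - ((m + n) w)\<^sup>2\<close> (\<open>cl_curvature_eq_iff\<close>). The hypothesis of the theorem says
  that the right-hand side is positive at the initial point, so there are exactly two initial
  Frenet curvatures.

  Where the right-hand side is positive, each of the two roots \<open>\<kappa> = F(s, p, \<theta>)\<close> is a smooth function of
  the arc length, the position and the angle. A curve whose Frenet curvature is that root is therefore
  the same thing as a solution of the system \<open>s' = 1\<close>, \<open>p' = (cos \<theta>, sin \<theta>)\<close>, \<open>\<theta>' = F(s, p, \<theta>)\<close>,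
  which is an autonomous equation \<open>x' = G(x)\<close> on an open subset of
  \<open>\<real> \<times> \<real>\<^sup>2 \<times> \<real>\<close> with \<open>G\<close> smooth. Its solutions exist by Picard's theorem (\<open>local_picard\<close>), and they are
  smooth because \<open>x\<close> being of class \<open>C\<^sup>r\<close> makes \<open>x' = G \<circ> x\<close> of class \<open>C\<^sup>r\<close> (\<open>solution_smooth\<close>).

  For uniqueness, a competitor is only known to satisfy the quadratic equation, and so might change to
  the other root elsewhere. It can do so only where the two roots coincide, and the constructed
  curve avoids that set. Hence the set of times at which position, angle and
  Frenet curvature of both curves agree is open: near such a time both curves follow the same root, and
  local uniqueness for the differential equation applies (\<open>local_uniqueness\<close>).
  That set is also closed, and it contains \<open>0\<close>, so it exhausts the common interval (\<open>prescribed_curve_unique\<close>).\<close>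

section \<open>Calculus of \<open>C\<^sup>r\<close> functions\<close>

text \<open>Derivatives of sums, products and composites are known in closed form only on \<open>S\<close>, whereas
  \<open>k_smooth_on\<close> recurses on \<open>frechet_derivative\<close>, which is a total function. Congruence on \<open>S\<close>
  bridges the gap.\<close>

lemma k_smooth_on_cong:
  assumes "open S" "\<And>x. x \<in> S \<Longrightarrow> f x = g x" "k_smooth_on r S f"
  shows "k_smooth_on r S g"
  using assms(2,3)
proof (induction r arbitrary: f g)
  case 0
  then show ?case by (simp cong: continuous_on_cong)
next
  case (Suc r)
  have D: "(g has_derivative frechet_derivative f (at x)) (at x)" if "x \<in> S" for x
  proof -
    have "(f has_derivative frechet_derivative f (at x)) (at x)"
      using Suc.prems(2) that by (simp add: frechet_derivative_works)
    then show ?thesis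
      by (rule has_derivative_transform_within_open[OF _ assms(1) that Suc.prems(1)])
  qed
  moreover have "k_smooth_on r S (\<lambda>x. frechet_derivative g (at x) v)" for v
  proof (rule Suc.IH[of "\<lambda>x. frechet_derivative f (at x) v"])
    show "frechet_derivative f (at x) v = frechet_derivative g (at x) v" if "x \<in> S" for x
      using frechet_derivative_at[OF D[OF that]] by simp
  qed (use Suc.prems in auto)
  ultimately show ?case by (auto simp: differentiable_def)
qed

lemma k_smooth_on_SucI:
  assumes "open S" "\<And>x. x \<in> S \<Longrightarrow> (f has_derivative f' x) (at x)"
    "\<And>v. k_smooth_on r S (\<lambda>x. f' x v)"
  shows "k_smooth_on (Suc r) S f"
proof -
  have "k_smooth_on r S (\<lambda>x. frechet_derivative f (at x) v)" for v
    by (rule k_smooth_on_cong[OF assms(1) _ assms(3)[of v]])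
       (use frechet_derivative_at[OF assms(2)] in metis)
  with assms(2) show ?thesis by (auto simp: differentiable_def)
qed

lemma k_smooth_on_SucD:
  assumes "k_smooth_on (Suc r) S f"
  shows "x \<in> S \<Longrightarrow> (f has_derivative frechet_derivative f (at x)) (at x)"
    "k_smooth_on r S (\<lambda>x. frechet_derivative f (at x) v)"
  using assms by (auto simp: frechet_derivative_works[symmetric])

lemma k_smooth_on_lower: "k_smooth_on (Suc r) S f \<Longrightarrow> k_smooth_on r S f"
proof (induction r arbitrary: f)
  case 0
  then show ?case
    by (auto intro!: continuous_at_imp_continuous_on differentiable_imp_continuous_within)
qed auto

lemma k_smooth_on_const: "open S \<Longrightarrow> k_smooth_on r S (\<lambda>x. c)"
  by (induction r arbitrary: c) (auto intro: k_smooth_on_SucI has_derivative_const)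

lemma k_smooth_on_linear:
  assumes L: "bounded_linear L" and S: "open S"
  shows "k_smooth_on r S f \<Longrightarrow> k_smooth_on r S (\<lambda>x. L (f x))"
proof (induction r arbitrary: f)
  case 0
  then show ?case by (simp add: L linear_continuous_on_compose bounded_linear.continuous_on)
next
  case (Suc r)
  show ?case
    by (rule k_smooth_on_SucI[OF S bounded_linear.has_derivative[OF L k_smooth_on_SucD(1)]])
       (use Suc k_smooth_on_SucD(2) in blast)+
qed

lemma k_smooth_on_ident: "open S \<Longrightarrow> k_smooth_on r S (\<lambda>x. x)"
  by (cases r) (auto intro!: k_smooth_on_SucI k_smooth_on_const has_derivative_ident simp del: k_smooth_on.simps(2))

lemma k_smooth_on_add:
  assumes S: "open S"
  shows "k_smooth_on r S f \<Longrightarrow> k_smooth_on r S g \<Longrightarrow> k_smooth_on r S (\<lambda>x. f x + g x)"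
proof (induction r arbitrary: f g)
  case 0
  then show ?case by (simp add: continuous_on_add)
next
  case (Suc r)
  show ?case
    by (rule k_smooth_on_SucI[OF S has_derivative_add[OF k_smooth_on_SucD(1)[OF Suc.prems(1)]
            k_smooth_on_SucD(1)[OF Suc.prems(2)]]])
       (use Suc k_smooth_on_SucD(2) in blast)+
qed

lemma k_smooth_on_sum:
  assumes "open S" "\<And>i. i \<in> A \<Longrightarrow> k_smooth_on r S (f i)"
  shows "k_smooth_on r S (\<lambda>x. \<Sum>i\<in>A. f i x)"
  using assms(2)
  by (induction A rule: infinite_finite_induct) (auto intro: k_smooth_on_const k_smooth_on_add assms(1))

lemma k_smooth_on_bilinear:
  assumes B: "bounded_bilinear B" and S: "open S"
  shows "k_smooth_on r S f \<Longrightarrow> k_smooth_on r S g \<Longrightarrow> k_smooth_on r S (\<lambda>x. B (f x) (g x))"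
proof (induction r arbitrary: f g)
  case 0
  then show ?case by (simp add: bounded_bilinear.continuous_on[OF B])
next
  case (Suc r)
  note l = Suc.prems[THEN k_smooth_on_lower]
  show ?case
  proof (rule k_smooth_on_SucI[OF S])
    show "((\<lambda>x. B (f x) (g x)) has_derivative
        (\<lambda>v. B (f x) (frechet_derivative g (at x) v) + B (frechet_derivative f (at x) v) (g x))) (at x)"
      if "x \<in> S" for x
      using bounded_bilinear.FDERIV[OF B k_smooth_on_SucD(1)[OF Suc.prems(1) that]
          k_smooth_on_SucD(1)[OF Suc.prems(2) that]] .
    show "k_smooth_on r S (\<lambda>x. B (f x) (frechet_derivative g (at x) v)
        + B (frechet_derivative f (at x) v) (g x))" for v
      by (intro k_smooth_on_add[OF S] Suc.IH l k_smooth_on_SucD(2)[OF Suc.prems(1)]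
          k_smooth_on_SucD(2)[OF Suc.prems(2)])
  qed
qed

lemmas k_smooth_on_mult = k_smooth_on_bilinear[OF bounded_bilinear_mult]
lemmas k_smooth_on_scaleR = k_smooth_on_bilinear[OF bounded_bilinear_scaleR]

lemma k_smooth_on_diff:
  assumes "open S" "k_smooth_on r S f" "k_smooth_on r S g"
  shows "k_smooth_on r S (\<lambda>x. f x - g x)"
  using k_smooth_on_add[OF assms(1,2) k_smooth_on_linear[OF bounded_linear_minus[OF bounded_linear_ident] assms(1,3)]]
  by simp

lemma k_smooth_on_Pair:
  assumes "open S" "k_smooth_on r S f" "k_smooth_on r S g"
  shows "k_smooth_on r S (\<lambda>x. (f x, g x))"
proof -
  have "bounded_linear (\<lambda>u. (u, 0))" "bounded_linear (\<lambda>u. (0, u))"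
    by (intro bounded_linear_Pair bounded_linear_ident bounded_linear_zero)+
  from k_smooth_on_add[OF assms(1) k_smooth_on_linear[OF this(1) assms(1,2)]
      k_smooth_on_linear[OF this(2) assms(1,3)]]
  show ?thesis by simp
qed

text \<open>Chain rule, expanded in an orthonormal basis of the intermediate space: each directional
  derivative of \<open>g \<circ> f\<close> becomes a sum of products of derivatives of \<open>f\<close> with composites
  \<open>\<partial>\<^sub>b g \<circ> f\<close>, and these are covered by the induction hypothesis.\<close>

lemma k_smooth_on_compose:
  fixes f :: "'a::real_normed_vector \<Rightarrow> 'b::euclidean_space"
    and g :: "'b \<Rightarrow> 'c::real_normed_vector"
  assumes S: "open S" and fS: "f ` S \<subseteq> T"
  shows "k_smooth_on r S f \<Longrightarrow> k_smooth_on r T g \<Longrightarrow> k_smooth_on r S (\<lambda>x. g (f x))"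
proof (induction r arbitrary: g)
  case 0
  then show ?case using fS by (auto intro: continuous_on_compose2)
next
  case (Suc r)
  let ?Df = "\<lambda>x. frechet_derivative f (at x)" and ?Dg = "\<lambda>x. frechet_derivative g (at x)"
  show ?case
  proof (rule k_smooth_on_SucI[OF S])
    fix x assume x: "x \<in> S"
    have dg: "(g has_derivative ?Dg (f x)) (at (f x))"
      by (rule k_smooth_on_SucD(1)[OF Suc.prems(2)]) (use x fS in auto)
    interpret Dg: bounded_linear "?Dg (f x)" using dg by (rule has_derivative_bounded_linear)
    have "?Dg (f x) (?Df x v) = (\<Sum>b\<in>Basis. (?Df x v \<bullet> b) *\<^sub>R ?Dg (f x) b)" for v
      by (subst euclidean_representation[symmetric]) (simp only: Dg.sum Dg.scaleR)
    with diff_chain_at[OF k_smooth_on_SucD(1)[OF Suc.prems(1) x] dg]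
    show "((\<lambda>x. g (f x)) has_derivative
        (\<lambda>v. \<Sum>b\<in>Basis. (?Df x v \<bullet> b) *\<^sub>R ?Dg (f x) b)) (at x)"
      by (simp add: o_def)
  next
    fix v
    show "k_smooth_on r S (\<lambda>x. \<Sum>b\<in>Basis. (?Df x v \<bullet> b) *\<^sub>R ?Dg (f x) b)"
      by (intro k_smooth_on_sum[OF S] k_smooth_on_scaleR[OF S] Suc.IH
          k_smooth_on_linear[OF bounded_linear_inner_left S]
          k_smooth_on_lower[OF Suc.prems(1)] k_smooth_on_SucD(2)[OF Suc.prems(1)]
          k_smooth_on_SucD(2)[OF Suc.prems(2)])
  qed
qed

lemma k_smooth_on_real_SucI:
  fixes f f' :: "real \<Rightarrow> real"
  assumes "open S" "\<And>x. x \<in> S \<Longrightarrow> (f has_real_derivative f' x) (at x)" "k_smooth_on r S f'"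
  shows "k_smooth_on (Suc r) S f"
  by (rule k_smooth_on_SucI[OF assms(1) assms(2)[unfolded has_field_derivative_def]])
     (auto intro!: k_smooth_on_mult assms k_smooth_on_const)

text \<open>The derivatives of \<open>sin\<close> and \<open>cos\<close> refer to each other, so both are treated in one induction.\<close>

lemma k_smooth_on_sin_cos: "k_smooth_on r UNIV (sin :: real \<Rightarrow> real) \<and> k_smooth_on r UNIV (cos :: real \<Rightarrow> real)"
proof (induction r)
  case 0
  then show ?case by (auto intro: continuous_intros)
next
  case (Suc r)
  have "k_smooth_on r UNIV (\<lambda>x::real. - sin x)"
    using k_smooth_on_linear[OF bounded_linear_minus[OF bounded_linear_ident]] Suc by auto
  with Suc show ?case
    by (auto intro!: k_smooth_on_real_SucI[where f = sin and f' = cos]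
        k_smooth_on_real_SucI[where f = cos and f' = "\<lambda>x. - sin x"] DERIV_sin DERIV_cos
        simp del: k_smooth_on.simps)
qed

lemma k_smooth_on_inverse: "k_smooth_on r {0::real<..} inverse"
proof (induction r)
  case 0
  then show ?case by (auto intro!: continuous_intros)
next
  case (Suc r)
  have "k_smooth_on r {0::real<..} (\<lambda>x. - (inverse x * inverse x))"
    by (intro k_smooth_on_linear[OF bounded_linear_minus[OF bounded_linear_ident]]
        k_smooth_on_mult Suc open_greaterThan)
  then show ?case
    by (rule k_smooth_on_real_SucI[rotated 2])
       (auto intro!: derivative_eq_intros simp: power2_eq_square)
qed

lemma k_smooth_on_sqrt: "k_smooth_on r {0<..} sqrt"
proof (induction r)
  case 0
  then show ?case by (auto intro!: continuous_intros)
next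
  case (Suc r)
  have "k_smooth_on r {0::real<..} (\<lambda>x. inverse (sqrt x) * (1/2))"
    by (intro k_smooth_on_mult k_smooth_on_const open_greaterThan
        k_smooth_on_compose[OF open_greaterThan _ Suc k_smooth_on_inverse]) auto
  then show ?case
    by (rule k_smooth_on_real_SucI[rotated 2]) (auto intro!: derivative_eq_intros)
qed

text \<open>On a compact ball the partial derivatives are bounded, hence so is the operator norm of the
  derivative, and the mean value inequality applies.\<close>

lemma k_smooth_on_imp_locally_lipschitz:
  fixes g :: "'a::euclidean_space \<Rightarrow> 'b::real_normed_vector"
  assumes "open S" "k_smooth_on (Suc 0) S g" "q \<in> S"
  obtains e L where "0 < e" "cball q e \<subseteq> S" "L-lipschitz_on (cball q e) g"
proof -
  obtain e where e: "0 < e" "cball q e \<subseteq> S" using assms open_contains_cball by blast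
  let ?D = "\<lambda>x. frechet_derivative g (at x)"
  have "\<exists>B. \<forall>x\<in>cball q e. norm (?D x b) \<le> B" for b
  proof -
    have "continuous_on (cball q e) (\<lambda>x. ?D x b)"
      using assms(2) e(2) by (auto intro: continuous_on_subset)
    then have "bounded ((\<lambda>x. ?D x b) ` cball q e)"
      by (intro compact_imp_bounded compact_continuous_image compact_cball)
    then show ?thesis by (auto simp: bounded_iff)
  qed
  then obtain B where B: "\<And>b x. x \<in> cball q e \<Longrightarrow> norm (?D x b) \<le> B b" by metis
  define L where "L = (\<Sum>b\<in>Basis. \<bar>B b\<bar>) + 1"
  have "0 < L" by (auto simp: L_def intro!: add_nonneg_pos sum_nonneg)
  have D: "(g has_derivative ?D x) (at x)" if "x \<in> cball q e" for x
    using k_smooth_on_SucD(1)[OF assms(2)] that e by blast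
  have "onorm (?D x) \<le> L" if x: "x \<in> cball q e" for x
  proof (rule onorm_bound)
    interpret Dg: bounded_linear "?D x" using D[OF x] by (rule has_derivative_bounded_linear)
    fix v
    have "norm (?D x v) = norm (\<Sum>b\<in>Basis. (v \<bullet> b) *\<^sub>R ?D x b)"
      by (subst (1) euclidean_representation[symmetric]) (simp only: Dg.sum Dg.scaleR)
    also have "\<dots> \<le> (\<Sum>b\<in>Basis. norm v * \<bar>B b\<bar>)"
    proof (rule sum_norm_le)
      fix b :: 'a assume b: "b \<in> Basis"
      have "norm (?D x b) \<le> \<bar>B b\<bar>" using B[OF x, of b] by linarith
      then show "norm ((v \<bullet> b) *\<^sub>R ?D x b) \<le> norm v * \<bar>B b\<bar>"
        using Basis_le_norm[OF b, of v] by (auto intro: mult_mono)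
    qed
    also have "\<dots> \<le> L * norm v"
      by (simp add: L_def sum_distrib_left[symmetric] algebra_simps)
    finally show "norm (?D x v) \<le> L * norm v" .
  qed (use \<open>0 < L\<close> in auto)
  then have "L-lipschitz_on (cball q e) g"
    using \<open>0 < L\<close>
    by (intro lipschitz_onI)
       (auto simp: dist_norm intro!: differentiable_bound[OF convex_cball has_derivative_at_withinI[OF D]])
  then show thesis using that e by blast
qed

lemma smooth_on_imp_continuous_on: "smooth_on S f \<Longrightarrow> continuous_on S f"
  unfolding smooth_on_def by (metis k_smooth_on.simps(1))

lemma smooth_on_imp_differentiable: "smooth_on S f \<Longrightarrow> x \<in> S \<Longrightarrow> f differentiable (at x)"
  unfolding smooth_on_def by (metis k_smooth_on.simps(2))

lemma smooth_on_deriv: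
  fixes f :: "real \<Rightarrow> real"
  assumes "smooth_on S f"
  shows "x \<in> S \<Longrightarrow> (f has_real_derivative deriv f x) (at x)" "continuous_on S (deriv f)"
proof -
  show D: "(f has_real_derivative deriv f x) (at x)" if "x \<in> S" for x
    using smooth_on_imp_differentiable[OF assms that]
    by (simp add: DERIV_deriv_iff_real_differentiable)
  have "continuous_on S (\<lambda>x. frechet_derivative f (at x) 1)"
    using assms unfolding smooth_on_def by (metis k_smooth_on.simps)
  moreover have "frechet_derivative f (at x) 1 = deriv f x" if "x \<in> S" for x
    using frechet_derivative_at[OF D[OF that, unfolded has_field_derivative_def], symmetric] by simp
  ultimately show "continuous_on S (deriv f)" by (simp cong: continuous_on_cong)
qed

section \<open>Autonomous ordinary differential equations\<close>

text \<open>Picard's theorem for a globally Lipschitz field. The solution is the fixed point of the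
  integral operator, a contraction with constant \<open>h * L\<close> for the supremum norm.\<close>

lemma global_picard:
  fixes G :: "'a::euclidean_space \<Rightarrow> 'a"
  assumes L: "L-lipschitz_on UNIV G" and h: "0 < h" "h * L < 1"
  obtains x where "x 0 = q" "\<And>t. t \<in> {-h..h} \<Longrightarrow> (x has_vector_derivative G (x t)) (at t within {-h..h})"
proof -
  \<comment> \<open>The integral from \<open>0\<close> to \<open>t\<close> is written as a difference of integrals from \<open>-h\<close>, so that
    negative \<open>t\<close> need no orientation.\<close>
  define A where "A u t = q + integral {-h..t} (\<lambda>s. G (u s)) - integral {-h..0} (\<lambda>s. G (u s))"
    for u :: "real \<Rightarrow> 'a" and t
  have L0: "0 \<le> L" using L lipschitz_on_nonneg by blast
  have A0: "A u 0 = q" for u by (simp add: A_def)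
  have contG: "continuous_on UNIV G" using L by (rule lipschitz_on_continuous_on)
  have dA: "(A u has_vector_derivative G (u t)) (at t within {-h..h})"
    if "continuous_on UNIV u" "t \<in> {-h..h}" for u t
  proof -
    have "continuous_on {-h..h} (\<lambda>s. G (u s))"
      by (rule continuous_on_compose2[OF contG]) (use that continuous_on_subset in auto)
    from integral_has_vector_derivative[OF this that(2)]
    show ?thesis unfolding A_def by (auto intro!: derivative_eq_intros)
  qed
  have contA: "continuous_on {-h..h} (A u)" if "continuous_on UNIV u" for u
    using dA[OF that] has_vector_derivative_continuous continuous_on_eq_continuous_within by blast
  \<comment> \<open>The complete space of bounded continuous functions lives on the whole line; constant
    extension beyond the end points moves the operator from \<open>[-h, h]\<close> to that space.\<close>
  define P where "P u = Bcontfun (ext_cont (A (apply_bcontfun u)) (-h) h)" for u :: "real \<Rightarrow>\<^sub>C 'a"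
  have cu: "continuous_on UNIV (apply_bcontfun u)" for u :: "real \<Rightarrow>\<^sub>C 'a"
    using apply_bcontfun[of u] by (simp add: bcontfun_def)
  have P: "apply_bcontfun (P u) t = A u (clamp (-h) h t)" for u t
  proof -
    have c: "continuous_on (cbox (-h) h) (A u)" using contA[OF cu] by simp
    have "continuous_on UNIV (ext_cont (A u) (-h) h)" unfolding ext_cont_def
      by (rule clamp_continuous_on[OF c])
    moreover have "bounded (range (ext_cont (A u) (-h) h))" unfolding ext_cont_def
      by (rule clamp_bounded) (intro compact_imp_bounded compact_continuous_image c compact_cbox)
    ultimately show ?thesis unfolding P_def
      by (subst Bcontfun_inverse) (auto simp: bcontfun_def ext_cont_def)
  qed
  have lip: "dist (P u) (P v) \<le> (h * L) * dist u v" for u v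
  proof (rule dist_bound)
    fix t :: real
    define c where "c = clamp (-h) h t"
    have c: "c \<in> {-h..h}" using clamp_in_interval[of "-h" h t] h by (auto simp: c_def)
    have "norm ((A u c - A v c) - (A u 0 - A v 0)) \<le> (L * dist u v) * norm (c - 0)"
    proof (rule differentiable_bound[where S = "{-h..h}" and f = "\<lambda>t. A u t - A v t"])
      fix s assume s: "s \<in> {-h..h}"
      show "((\<lambda>t. A u t - A v t) has_derivative (\<lambda>y. y *\<^sub>R (G (u s) - G (v s)))) (at s within {-h..h})"
        using has_vector_derivative_diff[OF dA[OF cu s] dA[OF cu s]]
        by (simp add: has_vector_derivative_def)
      have "norm (G (u s) - G (v s)) \<le> L * dist u v"
        using lipschitz_onD[OF L, of "u s" "v s"] dist_bounded[of u s v] L0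
        by (auto simp: dist_norm intro: order_trans mult_left_mono)
      then show "onorm (\<lambda>y. y *\<^sub>R (G (u s) - G (v s))) \<le> L * dist u v"
        using L0 by (intro onorm_bound) (auto simp: mult.commute intro: mult_left_mono mult_right_mono)
    qed (use h c in auto)
    then have "dist (P u t) (P v t) \<le> (L * dist u v) * \<bar>c\<bar>"
      by (simp add: P c_def[symmetric] A0 dist_norm)
    also have "\<dots> \<le> (L * dist u v) * h" using c L0 by (intro mult_left_mono) auto
    finally show "dist (P u t) (P v t) \<le> (h * L) * dist u v" by (simp add: mult_ac)
  qed
  obtain u where u: "P u = u"
    using banach_fix_type[of "h * L" P] lip h L0 by auto
  have ut: "u t = A u t" if "t \<in> {-h..h}" for t
    using P[of u t] clamp_cancel_cbox[of t "-h" h] that by (simp add: u)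
  show thesis
  proof
    show "apply_bcontfun u 0 = q" using ut[of 0] h by (simp add: A0)
    show "(apply_bcontfun u has_vector_derivative G (u t)) (at t within {-h..h})" if "t \<in> {-h..h}" for t
      using has_vector_derivative_transform[OF that ut dA[OF cu that]] by auto
  qed
qed

text \<open>A field that is Lipschitz only on a ball is extended by the nearest-point projection, which
  is \<open>1\<close>-Lipschitz. The solution for the extended field starts at the centre of the ball, so for a short
  time it stays in the ball, where both fields agree.\<close>

lemma local_picard:
  fixes G :: "'a::euclidean_space \<Rightarrow> 'a"
  assumes e: "0 < e" and L: "L-lipschitz_on (cball q e) G"
  obtains x h where "0 < h" "x 0 = q"
    "\<And>t. t \<in> {-h<..<h} \<Longrightarrow> x t \<in> cball q e"
    "\<And>t. t \<in> {-h<..<h} \<Longrightarrow> (x has_vector_derivative G (x t)) (at t)"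
proof -
  let ?r = "closest_point (cball q e)"
  have r: "?r y \<in> cball q e" for y by (rule closest_point_in_set) (use e in auto)
  have L0: "0 \<le> L" using L lipschitz_on_nonneg by blast
  have lip: "L-lipschitz_on UNIV (\<lambda>y. G (?r y))"
  proof (rule lipschitz_onI[OF _ L0])
    fix y z :: 'a
    have "dist (G (?r y)) (G (?r z)) \<le> L * dist (?r y) (?r z)" by (rule lipschitz_onD[OF L r r])
    also have "\<dots> \<le> L * dist y z"
      by (rule mult_left_mono[OF closest_point_lipschitz L0]) (use e in auto)
    finally show "dist (G (?r y)) (G (?r z)) \<le> L * dist y z" .
  qed
  define h where "h = 1 / (L + 1)"
  have h: "0 < h" "h * L < 1" using L0 by (auto simp: h_def field_simps)
  obtain x where x: "x 0 = q"
    "\<And>t. t \<in> {-h..h} \<Longrightarrow> (x has_vector_derivative G (?r (x t))) (at t within {-h..h})"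
    by (rule global_picard[OF lip h]) blast
  have "isCont x 0"
    using has_vector_derivative_continuous[OF x(2)[of 0]] h by (simp add: at_within_Icc_at)
  then obtain d where d: "0 < d" "\<And>t. \<bar>t\<bar> < d \<Longrightarrow> dist (x t) q < e"
    unfolding continuous_at_eps_delta x(1) using e by (auto simp: dist_real_def)
  show thesis
  proof
    show "0 < min h d" using h d by simp
    show "x 0 = q" by fact
    fix t assume t: "t \<in> {- min h d<..<min h d}"
    then have "dist (x t) q < e" by (intro d) auto
    then show "x t \<in> cball q e" by (simp add: dist_commute)
    moreover have "-h < t" "t < h" using t by auto
    ultimately show "(x has_vector_derivative G (x t)) (at t)"
      using x(2)[of t] by (simp add: closest_point_self at_within_Icc_at)
  qed
qed

text \<open>On an interval of radius \<open>r\<close> with \<open>L * r \<le> 1 / 2\<close>, the mean value inequality bounds the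
  maximum of \<open>norm (x t - y t)\<close> by half of itself, so the maximum is \<open>0\<close>.\<close>

lemma local_uniqueness:
  fixes G :: "'a::real_normed_vector \<Rightarrow> 'a"
  assumes e: "0 < e" and L: "L-lipschitz_on (cball q e) G"
    and x: "x a = q" "\<forall>\<^sub>F t in nhds a. (x has_vector_derivative G (x t)) (at t)"
    and y: "y a = q" "\<forall>\<^sub>F t in nhds a. (y has_vector_derivative G (y t)) (at t)"
  shows "\<forall>\<^sub>F t in nhds a. x t = y t"
proof -
  have near: "\<forall>\<^sub>F t in nhds a. z t \<in> cball q e"
    if "z a = q" "\<forall>\<^sub>F t in nhds a. (z has_vector_derivative G (z t)) (at t)" for z
  proof -
    have "isCont z a"
      using eventually_nhds_x_imp_x[OF that(2)] has_vector_derivative_continuous by blast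
    then have "(z \<longlongrightarrow> z a) (nhds a)" by (simp add: continuous_at tendsto_nhds_iff)
    from tendstoD[OF this e] show ?thesis
      by eventually_elim (simp add: that(1) dist_commute)
  qed
  have "\<forall>\<^sub>F t in nhds a. (x has_vector_derivative G (x t)) (at t) \<and> (y has_vector_derivative G (y t)) (at t)
      \<and> x t \<in> cball q e \<and> y t \<in> cball q e"
    by (intro eventually_conj x(2) y(2) near[OF x] near[OF y])
  then obtain d where d: "0 < d" "\<And>t. dist t a < d \<Longrightarrow>
      (x has_vector_derivative G (x t)) (at t) \<and> (y has_vector_derivative G (y t)) (at t)
      \<and> x t \<in> cball q e \<and> y t \<in> cball q e"
    unfolding eventually_nhds_metric by blast
  have L0: "0 \<le> L" using L lipschitz_on_nonneg by blast
  define r where "r = min (d / 2) (1 / (2 * (L + 1)))"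
  have r: "0 < r" "r < d" "L * r \<le> 1 / 2"
  proof -
    show "0 < r" "r < d" using d L0 by (auto simp: r_def min_def)
    have "L * r \<le> L * (1 / (2 * (L + 1)))" by (intro mult_left_mono) (auto simp: r_def L0)
    also have "\<dots> \<le> 1 / 2" using L0 by (simp add: field_simps)
    finally show "L * r \<le> 1 / 2" .
  qed
  let ?z = "\<lambda>t. x t - y t"
  have D: "t \<in> cball a r \<Longrightarrow> dist t a < d" for t using r by (simp add: dist_commute)
  have dz: "(?z has_vector_derivative G (x t) - G (y t)) (at t within cball a r)" if "t \<in> cball a r" for t
    by (rule has_vector_derivative_at_within[OF has_vector_derivative_diff])
       (use d(2)[OF D[OF that]] in blast)+
  have "continuous_on (cball a r) (\<lambda>t. norm (?z t))"
    by (rule continuous_on_norm[OF continuous_on_vector_derivative[OF dz]])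
  then obtain b where b: "b \<in> cball a r" "\<And>t. t \<in> cball a r \<Longrightarrow> norm (?z t) \<le> norm (?z b)"
    using continuous_attains_sup[of "cball a r" "\<lambda>t. norm (?z t)"] r by auto
  have "norm (?z b - ?z a) \<le> (L * norm (?z b)) * norm (b - a)"
  proof (rule differentiable_bound[where S = "cball a r"])
    fix t assume t: "t \<in> cball a r"
    show "(?z has_derivative (\<lambda>h. h *\<^sub>R (G (x t) - G (y t)))) (at t within cball a r)"
      using dz[OF t] by (simp add: has_vector_derivative_def)
    have "norm (G (x t) - G (y t)) \<le> L * norm (?z t)"
      using lipschitz_onD[OF L, of "x t" "y t"] d(2)[OF D[OF t]] by (simp add: dist_norm)
    also have "\<dots> \<le> L * norm (?z b)" using b(2)[OF t] L0 by (rule mult_left_mono)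
    finally show "onorm (\<lambda>h. h *\<^sub>R (G (x t) - G (y t))) \<le> L * norm (?z b)"
      using L0 by (intro onorm_bound) (auto simp: mult.commute intro: mult_left_mono mult_right_mono)
  qed (use b r in auto)
  also have "\<dots> \<le> (L * norm (?z b)) * r"
    using b(1) L0 by (intro mult_left_mono) (auto simp: dist_norm norm_minus_commute)
  also have "\<dots> = (L * r) * norm (?z b)" by simp
  also have "\<dots> \<le> 1 / 2 * norm (?z b)" by (rule mult_right_mono[OF r(3)]) simp
  finally have "norm (?z b) \<le> 0" by (simp add: x(1) y(1))
  with b(2) have "x t = y t" if "t \<in> cball a r" for t
    using that by (metis eq_iff_diff_eq_0 norm_le_zero_iff order_trans)
  then show ?thesis unfolding eventually_nhds_metric
    by (intro exI[of _ r]) (use r(1) in \<open>auto simp: dist_commute\<close>)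
qed

text \<open>Bootstrapping: the equation \<open>x' = G \<circ> x\<close> gains one derivative at each step.\<close>

lemma solution_smooth:
  fixes G :: "'a::euclidean_space \<Rightarrow> 'a"
  assumes S: "open S" "x ` S \<subseteq> \<Omega>" and G: "smooth_on \<Omega> G"
    and x: "\<And>t. t \<in> S \<Longrightarrow> (x has_vector_derivative G (x t)) (at t)"
  shows "smooth_on S x"
  unfolding smooth_on_def
proof
  fix r show "k_smooth_on r S x"
  proof (induction r)
    case 0
    show ?case unfolding k_smooth_on.simps
      by (rule continuous_on_vector_derivative[OF has_vector_derivative_at_within[OF x]])
  next
    case (Suc r)
    show ?case
    proof (rule k_smooth_on_SucI[OF S(1) x[unfolded has_vector_derivative_def]])
      show "k_smooth_on r S (\<lambda>t. v *\<^sub>R G (x t))" for v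
        using G unfolding smooth_on_def
        by (intro k_smooth_on_scaleR k_smooth_on_const S(1) k_smooth_on_compose[OF S Suc]) blast
    qed
  qed
qed

section \<open>The quadratic equation for the Frenet curvature\<close>

definition curvature_discriminant ::
  "real^2 \<Rightarrow> (real^2 \<Rightarrow> real) \<Rightarrow> (real^2 \<Rightarrow> real) \<Rightarrow> real^2 \<Rightarrow> real \<Rightarrow> real \<Rightarrow> real"
  where "curvature_discriminant W m n p t c = 2 * c\<^sup>2 - ((m p + n p) * (W \<bullet> normal_vec t))\<^sup>2"

text \<open>Completing the square: twice the radicand of \<open>cl_curvature\<close> is
  \<open>(2 \<kappa> - (m - n) \<langle>W, N\<rangle>)\<^sup>2 + ((m + n) \<langle>W, N\<rangle>)\<^sup>2\<close>.\<close>

lemma cl_curvature_eq_iff: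
  assumes "c > 0"
  shows "cl_curvature W m n p t \<kappa> = c \<longleftrightarrow>
    (2 * \<kappa> - (m p - n p) * (W \<bullet> normal_vec t))\<^sup>2 = curvature_discriminant W m n p t c"
proof -
  define w where "w = W \<bullet> normal_vec t"
  define R where "R = (\<kappa> + n p * w)\<^sup>2 + (m p * w - \<kappa>)\<^sup>2"
  have "sqrt R = c \<longleftrightarrow> R = c\<^sup>2"
    using assms by (auto simp: R_def intro: real_sqrt_unique)
  moreover have "2 * R = (2 * \<kappa> - (m p - n p) * w)\<^sup>2 + ((m p + n p) * w)\<^sup>2"
    unfolding R_def by algebra
  ultimately show ?thesis
    unfolding cl_curvature_def curvature_discriminant_def w_def[symmetric] R_def[symmetric] by auto
qed

lemma card_admissible_initial_curvatures:
  assumes "c > 0" "curvature_discriminant W m n p t c > 0"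
  shows "card (admissible_initial_curvatures W m n p t c) = 2"
proof -
  define b where "b = (m p - n p) * (W \<bullet> normal_vec t)"
  define d where "d = curvature_discriminant W m n p t c"
  have roots: "(2 * \<kappa> - b)\<^sup>2 = d \<longleftrightarrow> \<kappa> = (b + sqrt d) / 2 \<or> \<kappa> = (b - sqrt d) / 2" for \<kappa>
  proof -
    have "(2 * \<kappa> - b)\<^sup>2 = d \<longleftrightarrow> (2 * \<kappa> - b)\<^sup>2 = (sqrt d)\<^sup>2" using assms by (simp add: d_def)
    then show ?thesis unfolding power2_eq_iff by auto
  qed
  have "admissible_initial_curvatures W m n p t c = {(b + sqrt d) / 2, (b - sqrt d) / 2}"
    unfolding admissible_initial_curvatures_def cl_curvature_eq_iff[OF assms(1)] b_def[symmetric]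
      d_def[symmetric] roots by (simp add: set_eq_iff)
  then show ?thesis using assms(2) by (simp add: d_def)
qed

lemma inner_normal_vec_angle_vec: "angle_vec a \<bullet> normal_vec t = - sin (t - a)"
  by (simp add: angle_vec_def normal_vec_def inner_vec_def sum_2 sin_diff)

section \<open>The differential equation of the moving frame\<close>

text \<open>A state is a triple of arc length, position and tangent angle. Arc length is a coordinate, with
  speed \<open>1\<close>, so that the equation is autonomous although \<open>k\<close> depends on it. The parameter
  \<open>\<epsilon> = \<plusminus>1\<close> selects one of the two roots \<open>\<kappa>\<close> of the quadratic equation.\<close>

definition frame_field ::
  "real^2 \<Rightarrow> (real^2 \<Rightarrow> real) \<Rightarrow> (real^2 \<Rightarrow> real) \<Rightarrow> (real \<Rightarrow> real) \<Rightarrow> real \<Rightarrow>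
     real \<times> (real^2) \<times> real \<Rightarrow> real \<times> (real^2) \<times> real"
  where "frame_field W m n k \<epsilon> = (\<lambda>(s, p, t). (1, angle_vec t,
    ((m p - n p) * (W \<bullet> normal_vec t) + \<epsilon> * sqrt (curvature_discriminant W m n p t (k s))) / 2))"

text \<open>The strict inequality keeps the radicand away from \<open>0\<close>, where the square root fails to be
  differentiable.\<close>

definition frame_domain ::
  "real^2 \<Rightarrow> (real^2 \<Rightarrow> real) \<Rightarrow> (real^2 \<Rightarrow> real) \<Rightarrow> real set \<Rightarrow> (real \<Rightarrow> real) \<Rightarrow>
     (real \<times> (real^2) \<times> real) set"
  where "frame_domain W m n I k = {(s, p, t). s \<in> I \<and> 0 < curvature_discriminant W m n p t (k s)}"

lemma angle_vec_eq: "angle_vec t = cos t *\<^sub>R axis 1 1 + sin t *\<^sub>R axis 2 1"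
  by (simp add: angle_vec_def vec_eq_iff forall_2 axis_def)

lemma inner_normal_vec: "W \<bullet> normal_vec t = cos t * W $ 2 - sin t * W $ 1"
  by (simp add: normal_vec_def inner_vec_def sum_2)

locale curvature_problem =
  fixes W :: "real^2" and m n :: "real^2 \<Rightarrow> real" and I :: "real set" and k :: "real \<Rightarrow> real"
  assumes open_I: "open I" and k: "smooth_on I k" "\<And>s. s \<in> I \<Longrightarrow> k s > 0"
    and m: "smooth_on UNIV m" and n: "smooth_on UNIV n"
begin

abbreviation "disc \<equiv> curvature_discriminant W m n"
abbreviation "field \<equiv> frame_field W m n k"
abbreviation "\<Omega> \<equiv> frame_domain W m n I k"

lemma k_smooth_on_state:
  fixes S :: "(real \<times> (real^2) \<times> real) set"
  assumes S: "open S" and SI: "fst ` S \<subseteq> I"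
  shows "k_smooth_on r S (\<lambda>q. sin (snd (snd q)))" (is ?sin)
    and "k_smooth_on r S (\<lambda>q. cos (snd (snd q)))" (is ?cos)
    and "k_smooth_on r S (\<lambda>q. W \<bullet> normal_vec (snd (snd q)))" (is ?w)
    and "k_smooth_on r S (\<lambda>q. m (fst (snd q)))" (is ?m)
    and "k_smooth_on r S (\<lambda>q. n (fst (snd q)))" (is ?n)
    and "k_smooth_on r S (\<lambda>q. disc (fst (snd q)) (snd (snd q)) (k (fst q)))"
proof -
  note lin = k_smooth_on_linear[OF _ S k_smooth_on_ident[OF S]]
  have comp: "k_smooth_on r S (\<lambda>q. snd (snd q))" "k_smooth_on r S (\<lambda>q. fst (snd q))" "k_smooth_on r S fst"
    by (auto intro!: lin bounded_linear_compose[of snd snd] bounded_linear_compose[of fst snd]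
        bounded_linear_fst bounded_linear_snd)
  show s: ?sin and c: ?cos
    using k_smooth_on_sin_cos[of r] by (auto intro: k_smooth_on_compose[OF S subset_UNIV comp(1)])
  show w: ?w unfolding inner_normal_vec
    by (intro k_smooth_on_diff k_smooth_on_mult s c k_smooth_on_const S)
  show m': ?m and n': ?n
    using m n by (auto intro: k_smooth_on_compose[OF S subset_UNIV comp(2)] simp: smooth_on_def)
  have "k_smooth_on r S (\<lambda>q. k (fst q))"
    using k by (intro k_smooth_on_compose[OF S SI comp(3)]) (simp add: smooth_on_def)
  then show "k_smooth_on r S (\<lambda>q. disc (fst (snd q)) (snd (snd q)) (k (fst q)))"
    unfolding curvature_discriminant_def power2_eq_square
    by (intro k_smooth_on_diff k_smooth_on_mult k_smooth_on_add w m' n' k_smooth_on_const S)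
qed

lemma open_domain: "open \<Omega>"
proof -
  have O: "open (I \<times> (UNIV :: ((real^2) \<times> real) set))" by (intro open_Times open_I open_UNIV)
  have "continuous_on (I \<times> UNIV) (\<lambda>q. disc (fst (snd q)) (snd (snd q)) (k (fst q)))"
    using k_smooth_on_state(6)[OF O, of 0] by auto
  from continuous_on_open_vimage[OF O, THEN iffD1, OF this, rule_format, OF open_greaterThan[of 0]]
  have "open ((\<lambda>q. disc (fst (snd q)) (snd (snd q)) (k (fst q))) -` {0<..} \<inter> I \<times> UNIV)" .
  also have "\<dots> = \<Omega>" by (auto simp: frame_domain_def)
  finally show ?thesis .
qed

lemma smooth_field: "smooth_on \<Omega> (field \<epsilon>)"
  unfolding smooth_on_def
proof
  fix r
  have "fst ` \<Omega> \<subseteq> I" by (auto simp: frame_domain_def)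
  note c = k_smooth_on_state[OF open_domain this, of r]
  have sq: "k_smooth_on r \<Omega> (\<lambda>q. sqrt (disc (fst (snd q)) (snd (snd q)) (k (fst q))))"
    by (rule k_smooth_on_compose[OF open_domain _ c(6) k_smooth_on_sqrt])
       (auto simp: frame_domain_def)
  have "k_smooth_on r \<Omega> (\<lambda>q. (1, angle_vec (snd (snd q)),
      ((m (fst (snd q)) - n (fst (snd q))) * (W \<bullet> normal_vec (snd (snd q)))
        + \<epsilon> * sqrt (disc (fst (snd q)) (snd (snd q)) (k (fst q)))) * (1 / 2)))"
    unfolding angle_vec_eq
    by (intro k_smooth_on_Pair k_smooth_on_add k_smooth_on_diff k_smooth_on_mult k_smooth_on_scaleR
        c(1-5) sq k_smooth_on_const open_domain)
  then show "k_smooth_on r \<Omega> (field \<epsilon>)"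
    by (simp add: frame_field_def case_prod_unfold)
qed

lemma field_locally_lipschitz:
  assumes "q \<in> \<Omega>"
  obtains e L where "0 < e" "cball q e \<subseteq> \<Omega>" "L-lipschitz_on (cball q e) (field \<epsilon>)"
  using k_smooth_on_imp_locally_lipschitz[OF open_domain _ assms] smooth_field
  unfolding smooth_on_def by metis

section \<open>Existence\<close>

text \<open>The sign \<open>\<epsilon>\<close> is the one for which the frame field has the prescribed \<open>\<kappa>\<close> at the initial state.
  The last conclusion, that the two roots stay distinct along the curve, is what uniqueness rests on.\<close>

lemma prescribed_curve_exists:
  assumes I: "0 \<in> I" and d: "disc p t (k 0) > 0" and \<kappa>: "cl_curvature W m n p t \<kappa> = k 0"
  obtains J \<gamma> \<theta> where "prescribed_curvature_curve W m n I k p t J \<gamma> \<theta>" "deriv \<theta> 0 = \<kappa>"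
    "\<And>s. s \<in> J \<Longrightarrow> disc (\<gamma> s) (\<theta> s) (k s) > 0"
proof -
  define q where "q = (0 :: real, p, t)"
  have q: "q \<in> \<Omega>" using I d by (simp add: q_def frame_domain_def)
  define \<epsilon> where "\<epsilon> = sgn (2 * \<kappa> - (m p - n p) * (W \<bullet> normal_vec t))"
  note \<kappa>2 = \<kappa>[unfolded cl_curvature_eq_iff[OF k(2)[OF I]]]
  have \<epsilon>2: "\<epsilon>\<^sup>2 = 1" using \<kappa>2 d by (auto simp: \<epsilon>_def sgn_if)
  have \<kappa>\<epsilon>: "\<kappa> = snd (snd (field \<epsilon> q))"
  proof -
    have "2 * \<kappa> - (m p - n p) * (W \<bullet> normal_vec t) = \<epsilon> * sqrt (disc p t (k 0))"
      unfolding \<kappa>2[symmetric] \<epsilon>_def by (simp add: sgn_mult_abs)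
    then show ?thesis by (simp add: frame_field_def q_def)
  qed
  obtain e L where e: "0 < e" "cball q e \<subseteq> \<Omega>" "L-lipschitz_on (cball q e) (field \<epsilon>)"
    by (rule field_locally_lipschitz[OF q]) 
  obtain X h where h: "0 < h" and X: "X 0 = q" "\<And>s. s \<in> {-h<..<h} \<Longrightarrow> X s \<in> cball q e"
    "\<And>s. s \<in> {-h<..<h} \<Longrightarrow> (X has_vector_derivative field \<epsilon> (X s)) (at s)"
    by (rule local_picard[OF e(1,3)]) (rule that)
  define J where "J = {-h<..<h}"
  define \<gamma> where "\<gamma> = (\<lambda>s. fst (snd (X s)))"
  define \<theta> where "\<theta> = (\<lambda>s. snd (snd (X s)))"
  have J: "open J" "0 \<in> J" "is_interval J" using h by (auto simp: J_def is_interval_oo)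
  have dX: "(X has_vector_derivative field \<epsilon> (X s)) (at s)" if "s \<in> J" for s
    using X(3) that by (simp add: J_def)
  note lin = bounded_linear.has_vector_derivative[OF _ dX]
  \<comment> \<open>The first coordinate has derivative \<open>1\<close> and vanishes at \<open>0\<close>, so it is the parameter of the curve.\<close>
  have time: "fst (X s) = s" if s: "s \<in> J" for s
  proof -
    have "((\<lambda>u. fst (X u) - u) has_derivative (\<lambda>h. 0)) (at u within J)" if "u \<in> J" for u
      using has_vector_derivative_diff[OF lin[OF bounded_linear_fst that] has_vector_derivative_id]
      by (auto simp: has_vector_derivative_def frame_field_def case_prod_unfold
          intro: has_derivative_at_withinI)
    from has_derivative_zero_constant[OF is_interval_convex[OF J(3)] this]
    obtain c where "\<And>u. u \<in> J \<Longrightarrow> fst (X u) - u = c" by blast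
    from this[OF J(2)] this[OF s] show ?thesis by (simp add: X(1) q_def)
  qed
  have Xs: "X s = (s, \<gamma> s, \<theta> s)" if "s \<in> J" for s
    using time[OF that] by (simp add: \<gamma>_def \<theta>_def prod_eq_iff)
  have dom: "s \<in> I" "disc (\<gamma> s) (\<theta> s) (k s) > 0" if "s \<in> J" for s
    using X(2)[of s] e(2) that Xs[OF that] by (auto simp: J_def frame_domain_def)
  have d\<gamma>: "(\<gamma> has_vector_derivative angle_vec (\<theta> s)) (at s)" if "s \<in> J" for s
    using lin[OF bounded_linear_compose[OF bounded_linear_fst bounded_linear_snd] that]
    unfolding \<gamma>_def[symmetric] Xs[OF that] by (simp add: frame_field_def)
  have d\<theta>: "(\<theta> has_real_derivative snd (snd (field \<epsilon> (s, \<gamma> s, \<theta> s)))) (at s)" if "s \<in> J" for s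
    using lin[OF bounded_linear_compose[OF bounded_linear_snd bounded_linear_snd] that]
    unfolding \<theta>_def[symmetric] Xs[OF that] has_real_derivative_iff_has_vector_derivative .
  have "smooth_on J X"
    by (rule solution_smooth[OF J(1) _ smooth_field dX]) (use X(2) e(2) in \<open>auto simp: J_def\<close>)
  then have smooth: "smooth_on J \<gamma>" "smooth_on J \<theta>"
    unfolding smooth_on_def \<gamma>_def \<theta>_def
    by (auto intro!: k_smooth_on_linear[OF bounded_linear_compose[OF bounded_linear_fst bounded_linear_snd] J(1)]
        k_smooth_on_linear[OF bounded_linear_compose[OF bounded_linear_snd bounded_linear_snd] J(1)])
  have curv: "geodesic_curvature W m n \<gamma> \<theta> s = k s" if s: "s \<in> J" for s
  proof -
    have "2 * snd (snd (field \<epsilon> (s, \<gamma> s, \<theta> s))) - (m (\<gamma> s) - n (\<gamma> s)) * (W \<bullet> normal_vec (\<theta> s))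
        = \<epsilon> * sqrt (disc (\<gamma> s) (\<theta> s) (k s))"
      by (simp add: frame_field_def field_simps)
    then show ?thesis
      unfolding geodesic_curvature_def cl_curvature_eq_iff[OF k(2)[OF dom(1)[OF s]]]
        DERIV_imp_deriv[OF d\<theta>[OF s]]
      using dom(2)[OF s] \<epsilon>2 by (simp add: power_mult_distrib)
  qed
  have "norm (angle_vec a) = 1" for a
    by (simp add: angle_vec_def norm_eq_1 inner_vec_def sum_2 power2_eq_square[symmetric])
  moreover have "\<gamma> 0 = p" "\<theta> 0 = t" by (simp_all add: \<gamma>_def \<theta>_def X(1) q_def)
  ultimately have "prescribed_curvature_curve W m n I k p t J \<gamma> \<theta>"
    using J smooth curv dom(1) vector_derivative_at[OF d\<gamma>]
    unfolding prescribed_curvature_curve_def open_interval_around_0_def arc_length_curve_on_def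
      angle_function_on_def by auto
  moreover have "deriv \<theta> 0 = \<kappa>"
    unfolding DERIV_imp_deriv[OF d\<theta>[OF J(2)]] Xs[OF J(2), symmetric] X(1) \<kappa>\<epsilon> ..
  ultimately show thesis using dom(2) by (rule that)
qed

section \<open>Uniqueness\<close>

lemma prescribed_curveD:
  assumes "prescribed_curvature_curve W m n I k p t J \<gamma> \<theta>"
  shows "open J" "is_interval J" "0 \<in> J" "J \<subseteq> I" "\<gamma> 0 = p" "\<theta> 0 = t"
    "continuous_on J \<gamma>" "continuous_on J \<theta>" "continuous_on J (deriv \<theta>)"
    "s \<in> J \<Longrightarrow> (\<gamma> has_vector_derivative angle_vec (\<theta> s)) (at s)"
    "s \<in> J \<Longrightarrow> (\<theta> has_vector_derivative deriv \<theta> s) (at s)"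
    "s \<in> J \<Longrightarrow> (2 * deriv \<theta> s - (m (\<gamma> s) - n (\<gamma> s)) * (W \<bullet> normal_vec (\<theta> s)))\<^sup>2
      = disc (\<gamma> s) (\<theta> s) (k s)"
proof -
  have *: "open J" "is_interval J" "0 \<in> J" "J \<subseteq> I" "\<gamma> 0 = p" "\<theta> 0 = t" "smooth_on J \<gamma>" "smooth_on J \<theta>"
    "\<And>s. s \<in> J \<Longrightarrow> vector_derivative \<gamma> (at s) = angle_vec (\<theta> s)"
    "\<And>s. s \<in> J \<Longrightarrow> cl_curvature W m n (\<gamma> s) (\<theta> s) (deriv \<theta> s) = k s"
    using assms unfolding prescribed_curvature_curve_def open_interval_around_0_def
      arc_length_curve_on_def angle_function_on_def geodesic_curvature_def by auto
  show "open J" "is_interval J" "0 \<in> J" "J \<subseteq> I" "\<gamma> 0 = p" "\<theta> 0 = t" by fact+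
  show "continuous_on J \<gamma>" "continuous_on J \<theta>" "continuous_on J (deriv \<theta>)"
    using *(7,8) smooth_on_imp_continuous_on smooth_on_deriv(2) by blast+
  show "(\<theta> has_vector_derivative deriv \<theta> s) (at s)" if "s \<in> J"
    using smooth_on_deriv(1)[OF *(8) that] by (simp add: has_real_derivative_iff_has_vector_derivative)
  show "(\<gamma> has_vector_derivative angle_vec (\<theta> s)) (at s)" if "s \<in> J"
    using vector_derivative_works[THEN iffD1, OF smooth_on_imp_differentiable[OF *(7) that]]
    by (simp add: *(9)[OF that])
  show "(2 * deriv \<theta> s - (m (\<gamma> s) - n (\<gamma> s)) * (W \<bullet> normal_vec (\<theta> s)))\<^sup>2
      = disc (\<gamma> s) (\<theta> s) (k s)" if "s \<in> J"
    using *(10)[OF that] cl_curvature_eq_iff[OF k(2)] *(4) that by blast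
qed

lemma continuous_on_root_difference:
  assumes "prescribed_curvature_curve W m n I k p t J \<gamma> \<theta>"
  shows "continuous_on J (\<lambda>s. 2 * deriv \<theta> s - (m (\<gamma> s) - n (\<gamma> s)) * (W \<bullet> normal_vec (\<theta> s)))"
proof -
  note D = prescribed_curveD[OF assms]
  have "continuous_on J (\<lambda>s. m (\<gamma> s))" "continuous_on J (\<lambda>s. n (\<gamma> s))"
    using m n by (auto intro: continuous_on_compose2[OF smooth_on_imp_continuous_on D(7)])
  then show ?thesis unfolding inner_normal_vec by (intro continuous_intros D(8,9))
qed

text \<open>The expression \<open>2 \<kappa> - (m - n) w\<close> is continuous along the curve, so its sign at \<open>a\<close> persists nearby.
  Together with its square, which is the discriminant, this sign determines \<open>\<kappa>\<close>.\<close>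

lemma lift_follows_field:
  assumes P: "prescribed_curvature_curve W m n I k p t J \<gamma> \<theta>" and a: "a \<in> J"
    and pos: "0 < \<epsilon> * (2 * deriv \<theta> a - (m (\<gamma> a) - n (\<gamma> a)) * (W \<bullet> normal_vec (\<theta> a)))"
    and \<epsilon>: "\<bar>\<epsilon>\<bar> = 1"
  shows "\<forall>\<^sub>F s in nhds a. ((\<lambda>s. (s, \<gamma> s, \<theta> s)) has_vector_derivative field \<epsilon> (s, \<gamma> s, \<theta> s)) (at s)"
proof -
  define R where "R = (\<lambda>s. 2 * deriv \<theta> s - (m (\<gamma> s) - n (\<gamma> s)) * (W \<bullet> normal_vec (\<theta> s)))"
  have "continuous_on J (\<lambda>s. \<epsilon> * R s)"
    unfolding R_def by (intro continuous_on_mult continuous_on_const continuous_on_root_difference[OF P])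
  then have "isCont (\<lambda>s. \<epsilon> * R s) a"
    using continuous_on_eq_continuous_at[OF prescribed_curveD(1)[OF P]] a by blast
  then have "((\<lambda>s. \<epsilon> * R s) \<longlongrightarrow> \<epsilon> * R a) (nhds a)"
    by (simp add: continuous_at tendsto_nhds_iff)
  from order_tendstoD(1)[OF this] pos have "\<forall>\<^sub>F s in nhds a. 0 < \<epsilon> * R s" by (simp add: R_def)
  moreover have "\<forall>\<^sub>F s in nhds a. s \<in> J"
    by (rule eventually_nhds_in_open[OF prescribed_curveD(1)[OF P] a])
  ultimately show ?thesis
  proof eventually_elim
    case (elim s)
    have "\<epsilon> * \<epsilon> = 1" using \<epsilon> by (metis abs_mult_self_eq mult_1)
    moreover have "sqrt (disc (\<gamma> s) (\<theta> s) (k s)) = \<bar>R s\<bar>"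
      using prescribed_curveD(12)[OF P elim(2)] unfolding R_def by (metis real_sqrt_abs)
    moreover have "\<bar>R s\<bar> = \<epsilon> * R s"
      using abs_of_pos[OF elim(1)] \<epsilon> by (simp add: abs_mult)
    ultimately have "\<epsilon> * sqrt (disc (\<gamma> s) (\<theta> s) (k s)) = R s"
      by (simp add: mult.assoc[symmetric])
    then have "field \<epsilon> (s, \<gamma> s, \<theta> s) = (1, angle_vec (\<theta> s), deriv \<theta> s)"
      by (simp add: frame_field_def R_def)
    then show ?case
      by (auto intro!: has_vector_derivative_Pair prescribed_curveD(10,11)[OF P elim(2)]
          has_vector_derivative_id)
  qed
qed

text \<open>At a time of agreement, positivity of the discriminant passes from the first curve to its
  competitor, so there both have a definite root to follow.\<close>

lemma prescribed_curve_unique: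
  assumes P: "prescribed_curvature_curve W m n I k p t J \<gamma> \<theta>"
    and pos: "\<And>s. s \<in> J \<Longrightarrow> disc (\<gamma> s) (\<theta> s) (k s) > 0"
    and P': "prescribed_curvature_curve W m n I k p t J' \<gamma>' \<theta>'"
    and init: "deriv \<theta>' 0 = deriv \<theta> 0"
    and s: "s \<in> J \<inter> J'"
  shows "\<gamma>' s = \<gamma> s"
proof -
  note D = prescribed_curveD[OF P] and D' = prescribed_curveD[OF P']
  define S where "S = J \<inter> J'"
  \<comment> \<open>The Frenet curvature must be part of the data compared: if only position and angle agree
    at a time, the two curves may leave along different roots.\<close>
  define Y where "Y = (\<lambda>s. (\<gamma> s, \<theta> s, deriv \<theta> s))"
  define Y' where "Y' = (\<lambda>s. (\<gamma>' s, \<theta>' s, deriv \<theta>' s))"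
  define A where "A = {s \<in> S. Y s - Y' s = 0}"
  have S: "open S" "connected S" "0 \<in> S"
    using D(1-3) D'(1-3) is_interval_Int is_interval_connected by (auto simp: S_def)
  have "continuous_on S (\<lambda>s. Y s - Y' s)"
    unfolding Y_def Y'_def S_def
    by (intro continuous_intros) (auto intro: continuous_on_subset D(7-9) D'(7-9))
  then have "closedin (top_of_set S) A"
    unfolding A_def by (rule continuous_closedin_preimage_constant)
  moreover have "open A"
    unfolding open_subopen[of A]
  proof
    fix a assume "a \<in> A"
    then have a: "a \<in> J" "a \<in> J'" "a \<in> S" and eq: "Y' a = Y a" by (auto simp: A_def S_def)
    define \<epsilon> where "\<epsilon> = sgn (2 * deriv \<theta> a - (m (\<gamma> a) - n (\<gamma> a)) * (W \<bullet> normal_vec (\<theta> a)))"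
    define q where "q = (a, \<gamma> a, \<theta> a)"
    have q: "q \<in> \<Omega>" using pos[OF a(1)] D(4) a(1) by (auto simp: q_def frame_domain_def)
    have R: "2 * deriv \<theta> a - (m (\<gamma> a) - n (\<gamma> a)) * (W \<bullet> normal_vec (\<theta> a)) \<noteq> 0"
      using D(12)[OF a(1)] pos[OF a(1)] by auto
    then have \<epsilon>: "\<bar>\<epsilon>\<bar> = 1"
      "0 < \<epsilon> * (2 * deriv \<theta> a - (m (\<gamma> a) - n (\<gamma> a)) * (W \<bullet> normal_vec (\<theta> a)))"
      by (simp_all add: \<epsilon>_def abs_sgn_eq sgn_if)
    then have \<epsilon>': "0 < \<epsilon> * (2 * deriv \<theta>' a - (m (\<gamma>' a) - n (\<gamma>' a)) * (W \<bullet> normal_vec (\<theta>' a)))"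
      using eq by (simp add: Y_def Y'_def)
    obtain e L where e: "0 < e" "L-lipschitz_on (cball q e) (field \<epsilon>)"
      by (rule field_locally_lipschitz[OF q])
    have "\<forall>\<^sub>F s in nhds a. (s, \<gamma> s, \<theta> s) = (s, \<gamma>' s, \<theta>' s)"
      by (rule local_uniqueness[OF e _ lift_follows_field[OF P a(1) \<epsilon>(2,1)]
            _ lift_follows_field[OF P' a(2) \<epsilon>' \<epsilon>(1)]])
         (use eq in \<open>auto simp: q_def Y_def Y'_def\<close>)
    then obtain T where T: "open T" "a \<in> T" "\<And>s. s \<in> T \<Longrightarrow> \<gamma> s = \<gamma>' s \<and> \<theta> s = \<theta>' s"
      unfolding eventually_nhds by auto
    have "deriv \<theta> s = deriv \<theta>' s" if "s \<in> T" for s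
      by (rule deriv_cong_ev) (use T that in \<open>auto simp: eventually_nhds\<close>)
    with T S(1) a(3) show "\<exists>T. open T \<and> a \<in> T \<and> T \<subseteq> A"
      by (intro exI[of _ "S \<inter> T"]) (auto simp: A_def Y_def Y'_def zero_prod_def)
  qed
  then have "openin (top_of_set S) A" using S(1) by (auto simp: openin_open_eq A_def)
  moreover have "0 \<in> A"
    using S(3) D(5,6) D'(5,6) init by (simp add: A_def Y_def Y'_def zero_prod_def)
  ultimately have "A = S"
    using S connected_clopen[of S] by auto
  then have "Y s - Y' s = 0" using s by (auto simp: A_def S_def)
  then show ?thesis by (simp add: Y_def Y'_def zero_prod_def)
qed

end

section \<open>Curves of prescribed geodesic curvature\<close>

theorem theorem4p5:
  fixes nabla :: "(real^2 \<Rightarrow> real^2) \<Rightarrow> (real^2 \<Rightarrow> real^2) \<Rightarrow> real^2 \<Rightarrow> real^2"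
    and W :: "real^2" and m n :: "real^2 \<Rightarrow> real"
    and I :: "real set" and k :: "real \<Rightarrow> real"
    and p\<^sub>0 :: "real^2" and \<theta>\<^sub>0 \<theta>\<^sub>s :: real
  assumes "open_interval_around_0 I"
    and "smooth_on I k" and "\<forall>s\<in>I. k s > 0"
    and "is_cl_connection nabla W m n"
    and "W = angle_vec \<theta>\<^sub>0"
    and "2 * (k 0)\<^sup>2 > (sin (\<theta>\<^sub>s - \<theta>\<^sub>0))\<^sup>2 * (m p\<^sub>0 + n p\<^sub>0)\<^sup>2"
  shows "card (admissible_initial_curvatures W m n p\<^sub>0 \<theta>\<^sub>s (k 0)) = 2 \<and>
    (\<forall>\<kappa>\<^sub>0 \<in> admissible_initial_curvatures W m n p\<^sub>0 \<theta>\<^sub>s (k 0).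
       \<exists>J \<gamma> \<theta>. prescribed_curvature_curve W m n I k p\<^sub>0 \<theta>\<^sub>s J \<gamma> \<theta> \<and> deriv \<theta> 0 = \<kappa>\<^sub>0 \<and>
         (\<forall>J' \<gamma>' \<theta>'. prescribed_curvature_curve W m n I k p\<^sub>0 \<theta>\<^sub>s J' \<gamma>' \<theta>' \<and> deriv \<theta>' 0 = \<kappa>\<^sub>0 \<longrightarrow>
            (\<forall>s \<in> J \<inter> J'. \<gamma>' s = \<gamma> s)))"
proof (intro conjI ballI)
  interpret curvature_problem W m n I k
    using assms by unfold_locales (auto simp: open_interval_around_0_def is_cl_connection_def)
  have I: "0 \<in> I" using assms(1) by (simp add: open_interval_around_0_def)
  have d: "disc p\<^sub>0 \<theta>\<^sub>s (k 0) > 0"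
    using assms(6) by (simp add: assms(5) curvature_discriminant_def inner_normal_vec_angle_vec
        power_mult_distrib mult.commute)
  show "card (admissible_initial_curvatures W m n p\<^sub>0 \<theta>\<^sub>s (k 0)) = 2"
    by (rule card_admissible_initial_curvatures[OF k(2)[OF I] d])
  fix \<kappa>\<^sub>0 assume "\<kappa>\<^sub>0 \<in> admissible_initial_curvatures W m n p\<^sub>0 \<theta>\<^sub>s (k 0)"
  then have "cl_curvature W m n p\<^sub>0 \<theta>\<^sub>s \<kappa>\<^sub>0 = k 0" by (simp add: admissible_initial_curvatures_def)
  from prescribed_curve_exists[OF I d this] obtain J \<gamma> \<theta> where
    P: "prescribed_curvature_curve W m n I k p\<^sub>0 \<theta>\<^sub>s J \<gamma> \<theta>" "deriv \<theta> 0 = \<kappa>\<^sub>0"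
    "\<And>s. s \<in> J \<Longrightarrow> disc (\<gamma> s) (\<theta> s) (k s) > 0" by blast
  have "\<gamma>' s = \<gamma> s"
    if "prescribed_curvature_curve W m n I k p\<^sub>0 \<theta>\<^sub>s J' \<gamma>' \<theta>'" "deriv \<theta>' 0 = \<kappa>\<^sub>0" "s \<in> J \<inter> J'"
    for J' \<gamma>' \<theta>' s
    using prescribed_curve_unique[OF P(1,3) that(1) _ that(3)] that(2) P(2) by simp
  with P show "\<exists>J \<gamma> \<theta>. prescribed_curvature_curve W m n I k p\<^sub>0 \<theta>\<^sub>s J \<gamma> \<theta> \<and> deriv \<theta> 0 = \<kappa>\<^sub>0 \<and>
         (\<forall>J' \<gamma>' \<theta>'. prescribed_curvature_curve W m n I k p\<^sub>0 \<theta>\<^sub>s J' \<gamma>' \<theta>' \<and> deriv \<theta>' 0 = \<kappa>\<^sub>0 \<longrightarrow>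
            (\<forall>s \<in> J \<inter> J'. \<gamma>' s = \<gamma> s))"
    by blast
qed

end
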